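(* Let $(e_k)_{k\ge1}$ be a sequence of real numbers satisfying the Weyl growth condition: there exist $\epsilon>0$ and $\delta>0$ such that $|e_n-e_m|>\delta$ for all indices $n,m$ with $|n-m|>n/(\log n)^{1+\epsilon}$. For $n\ge1$ and $t\in\mathbb R$ let $r_n(t)=\prod_{k=1}^n\cos(e_k t)$. Then for Lebesgue-almost every $t\in\mathbb R$, $$\lim_{n\to\infty}\frac1n\log|r_n(t)|=-\log 2.$$
   Context: $r_n(t)$ is the decoherence factor of the spin bath model with $n$ environment spins and coupling constants $e_1,\dots,e_n$. *)

theory Defs
  imports "HOL-Analysis.Analysis"
begin

definition decoh :: "(nat \<Rightarrow> real) \<Rightarrow> nat \<Rightarrow> real \<Rightarrow> real" where
  "decoh e n t = (\<Prod>k=1..n. cos (e k * t))"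

end

theory Submission
  imports Defs "HOL-Probability.Probability" "HOL-Real_Asymp.Real_Asymp"
begin

text \<open>
  For \<open>0 < r < 1\<close> write \<open>ln \<bar>2 cos x\<bar> = h\<^sub>r(x) - (ln r) / 2 - g\<^sub>r(x)\<close>, where
  \<open>h\<^sub>r(x) = ln \<bar>1 + r exp(2ix)\<bar>\<close> has the absolutely convergent Fourier series with coefficients
  \<open>\<plusminus>r^j/j\<close>, and \<open>g\<^sub>r \<ge> 0\<close> carries the logarithmic singularity. Let \<open>t\<close> be standard normal, so that
  \<open>E cos(\<omega>t) = exp(-\<omega>\<^sup>2/2)\<close>. Then \<open>E g\<^sub>r(e t) = O(1 - r)\<close> for \<open>e\<close> away from \<open>0\<close>,
  while by Cauchy--Schwarz over the Fourier modes the second moment of the average of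
  \<open>h\<^sub>r(e\<^sub>k t)\<close> over \<open>k \<le> N\<close> is at most \<open>(ln (1 - r))\<^sup>2\<close> times the proportion of pairs \<open>k, l \<le> N\<close> for
  which \<open>e\<^sub>k \<plusminus> e\<^sub>l\<close> is small; the growth condition makes this proportion \<open>O((ln N)^(-1-\<epsilon>))\<close>.
  Along \<open>N = \<lfloor>exp(i^\<alpha>)\<rfloor>\<close> with \<open>1/(1+\<epsilon>) < \<alpha> < 1\<close>, and with \<open>1 - r = (i + 2)^(-2)\<close>, both bounds are
  summable, which gives almost sure convergence along this subsequence. Since \<open>-ln \<bar>cos\<bar> \<ge> 0\<close>, the
  partial sums are monotone, and \<open>\<alpha> < 1\<close> makes consecutive terms of the subsequence asymptotic
  to each other, so the full sequence of averages converges as well.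
\<close>

subsection \<open>Regularised logarithm of the cosine\<close>

text \<open>The argument is the squared modulus of \<open>1 + r * cis (2 * x)\<close>, so this is
  the real part of \<open>Ln (1 + z)\<close> at \<open>z = r * cis (2 * x)\<close>. At
  \<open>r = 1\<close> it formally becomes the logarithm of
  \<open>\<bar>2 * cos x\<bar>\<close>.\<close>

definition reg_logcos :: "real \<Rightarrow> real \<Rightarrow> real" where
  "reg_logcos r x = ln ((1 - r)\<^sup>2 + 4 * r * (cos x)\<^sup>2) / 2"

lemma reg_logcos_arg_pos:
  fixes r x :: real
  assumes "0 \<le> r" "r < 1"
  shows "0 < (1 - r)\<^sup>2 + 4 * r * (cos x)\<^sup>2"
proof -
  have "0 < (1 - r)\<^sup>2" using assms by (intro zero_less_power) simp
  moreover have "0 \<le> 4 * r * (cos x)\<^sup>2" using assms by simp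
  ultimately show ?thesis by linarith
qed

text \<open>Real part of the power series of \<open>Ln (1 + z)\<close> at
  \<open>z = r * cis (2 * x)\<close>, with De Moivre for the powers of \<open>z\<close>. The term
  \<open>j = 0\<close> vanishes because division by zero gives 0.\<close>

lemma reg_logcos_sums:
  assumes "0 \<le> r" "r < 1"
  shows "(\<lambda>j. - ((- r) ^ j) / real j * cos (2 * real j * x)) sums reg_logcos r x"
proof -
  define z where "z = complex_of_real r * cis (2 * x)"
  have nz: "cmod z < 1" using assms by (simp add: z_def norm_mult)
  then have "(\<lambda>n. - ((- z) ^ n) / of_nat n) sums Ln (1 + z)"
    by (rule Ln_series')
  then have "(\<lambda>n. Re (- ((- z) ^ n) / of_nat n)) sums Re (Ln (1 + z))"
    by (rule sums_Re)
  moreover have re: "Re (- ((- z) ^ n) / of_nat n) = - ((- r) ^ n) / real n * cos (2 * real n * x)" for n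
  proof -
    have "- z = complex_of_real (- r) * cis (2 * x)"
      by (simp add: z_def)
    then have "(- z) ^ n = complex_of_real ((- r) ^ n) * cis (real n * (2 * x))"
      by (simp only: power_mult_distrib Complex.DeMoivre of_real_power)
    then have "- ((- z) ^ n) / of_nat n = complex_of_real (- ((- r) ^ n) / real n) * cis (real n * (2 * x))"
      by simp
    then have "Re (- ((- z) ^ n) / of_nat n) = - ((- r) ^ n) / real n * cos (real n * (2 * x))"
      by (simp del: of_real_divide add: Re_divide)
    then show ?thesis by (simp add: mult_ac)
  qed
  moreover have "Re (Ln (1 + z)) = reg_logcos r x"
  proof -
    have "1 + z \<noteq> 0"
      using nz by (auto simp: add_eq_0_iff)
    then have "Re (Ln (1 + z)) = ln (cmod (1 + z))" by (rule Re_Ln)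
    also have "cmod (1 + z) = sqrt ((1 - r)\<^sup>2 + 4 * r * (cos x)\<^sup>2)"
    proof -
      have "(1 + r * cos (2 * x))\<^sup>2 + (r * sin (2 * x))\<^sup>2 =
          1 + 2 * r * cos (2 * x) + r\<^sup>2 * ((sin (2 * x))\<^sup>2 + (cos (2 * x))\<^sup>2)"
        by algebra
      also have "\<dots> = 1 + 2 * r * cos (2 * x) + r\<^sup>2" by simp
      also have "\<dots> = (1 - r)\<^sup>2 + 4 * r * (cos x)\<^sup>2"
        unfolding cos_double_cos by algebra
      finally show ?thesis by (simp add: cmod_def z_def)
    qed
    finally show ?thesis
      using ln_sqrt[OF less_imp_le[OF reg_logcos_arg_pos[OF assms, of x]]] by (simp only: reg_logcos_def)
  qed
  ultimately show ?thesis unfolding re by simp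
qed

text \<open>This is the total absolute mass of the Fourier coefficients. It grows only
  logarithmically as \<open>r\<close> approaches 1, which is why \<open>r\<close> may later tend to
  1 along the subsequence.\<close>

lemma abs_coeff_sums:
  assumes "0 \<le> r" "r < 1"
  shows "(\<lambda>j. r ^ j / real j) sums (- ln (1 - r))"
  using sums_minus[OF Complex_Transcendental.ln_series'[of "- r"]] assms by simp

section \<open>Gaussian expectations and almost sure convergence\<close>

lemma integrable_cos_std_normal: "integrable std_normal_distribution (\<lambda>t. cos (\<omega> * t))"
proof -
  interpret real_distribution std_normal_distribution by (rule real_dist_normal_dist)
  show ?thesis by (rule integrable_const_bound[where B=1]) auto
qed

lemma integral_cos_std_normal:
  "(LINT t|std_normal_distribution. cos (\<omega> * t)) = exp (- (\<omega>\<^sup>2) / 2)"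
proof -
  interpret real_distribution std_normal_distribution by (rule real_dist_normal_dist)
  have "(LINT t|std_normal_distribution. Re (iexp (\<omega> * t))) = Re (char std_normal_distribution \<omega>)"
    unfolding char_def by (rule integral_Re) (rule integrable_iexp, auto)
  then show ?thesis by (simp add: char_std_normal_distribution Re_exp)
qed

text \<open>A rational kernel replaces the Gaussian one: its quadratic decay is all that the later
  sums require.\<close>

lemma exp_neg_half_square_le: "exp (- (\<omega>\<^sup>2) / 2) \<le> 1 / (1 + \<omega>\<^sup>2 / 2)" for \<omega> :: real
proof -
  have "1 + \<omega>\<^sup>2 / 2 \<le> exp (\<omega>\<^sup>2 / 2)" by (rule exp_ge_add_one_self)
  moreover have "0 < 1 + \<omega>\<^sup>2 / 2" by (simp add: add_pos_nonneg)
  ultimately show ?thesis by (simp add: exp_minus field_simps)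
qed

text \<open>The normal density is positive everywhere, so a Gaussian null set is a Lebesgue null
  set.\<close>

lemma AE_std_normal_imp_lborel:
  assumes "AE t in std_normal_distribution. P t"
  shows "AE t in lborel. P t"
  using assms by (simp add: AE_density normal_density_pos)

text \<open>Summable expectations make the expectation of the series finite, so the series converges
  almost everywhere and its terms tend to 0. The shift by \<open>i0\<close> skips the indices where
  the bound may fail.\<close>

lemma AE_tendsto_0_of_summable_nn_integral:
  fixes X :: "nat \<Rightarrow> 'a \<Rightarrow> real"
  assumes meas: "\<And>i. X i \<in> borel_measurable M" and nonneg: "\<And>i x. 0 \<le> X i x"
    and bound: "\<forall>\<^sub>F i in sequentially. (\<integral>\<^sup>+x. ennreal (X i x) \<partial>M) \<le> ennreal (b i)"
    and b_nonneg: "\<And>i. 0 \<le> b i" and summ: "summable b"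
  shows "AE x in M. (\<lambda>i. X i x) \<longlonglongrightarrow> 0"
proof -
  obtain i0 where i0: "\<And>i. i \<ge> i0 \<Longrightarrow> (\<integral>\<^sup>+x. ennreal (X i x) \<partial>M) \<le> ennreal (b i)"
    using bound by (auto simp: eventually_sequentially)
  have sb: "summable (\<lambda>i. b (i + i0))"
    using summ by (simp add: summable_iff_shift)
  have "(\<integral>\<^sup>+x. (\<Sum>i. ennreal (X (i + i0) x)) \<partial>M) = (\<Sum>i. \<integral>\<^sup>+x. ennreal (X (i + i0) x) \<partial>M)"
    using meas by (intro nn_integral_suminf) auto
  also have "\<dots> \<le> (\<Sum>i. ennreal (b (i + i0)))"
    by (intro suminf_le i0) auto
  also have "\<dots> = ennreal (\<Sum>i. b (i + i0))"
    using b_nonneg sb by (intro suminf_ennreal2) auto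
  finally have "(\<integral>\<^sup>+x. (\<Sum>i. ennreal (X (i + i0) x)) \<partial>M) \<noteq> \<infinity>"
    by (auto simp: top_unique)
  then have "AE x in M. (\<Sum>i. ennreal (X (i + i0) x)) \<noteq> \<infinity>"
    using meas by (intro nn_integral_PInf_AE) auto
  then show ?thesis
  proof eventually_elim
    case (elim x)
    then have "summable (\<lambda>i. X (i + i0) x)"
      using nonneg by (intro summable_suminf_not_top) auto
    then have "(\<lambda>i. X (i + i0) x) \<longlonglongrightarrow> 0" by (rule summable_LIMSEQ_zero)
    then show ?case by (rule LIMSEQ_offset)
  qed
qed

section \<open>Second moments of the regularised sums\<close>

lemma square_suminf_le:
  fixes c T :: "nat \<Rightarrow> real"
  assumes s: "(\<lambda>j. c j * T j) sums s" and L: "(\<lambda>j. \<bar>c j\<bar>) sums L" and K: "\<And>j. \<bar>T j\<bar> \<le> K"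
  shows "summable (\<lambda>j. \<bar>c j\<bar> * (T j)\<^sup>2)" and "s\<^sup>2 \<le> L * (\<Sum>j. \<bar>c j\<bar> * (T j)\<^sup>2)"
proof -
  have T2: "(T j)\<^sup>2 \<le> K\<^sup>2" for j
    using K[of j] power_mono[of "\<bar>T j\<bar>" K 2] by simp
  have "summable (\<lambda>j. \<bar>c j\<bar> * K\<^sup>2)"
    using L by (intro summable_mult2) (rule sums_summable)
  then show sm: "summable (\<lambda>j. \<bar>c j\<bar> * (T j)\<^sup>2)"
    by (rule summable_comparison_test'[where N=0]) (simp add: T2 mult_left_mono)
  have L0: "0 \<le> L"
    using suminf_nonneg[OF sums_summable[OF L]] sums_unique[OF L] by simp
  show "s\<^sup>2 \<le> L * (\<Sum>j. \<bar>c j\<bar> * (T j)\<^sup>2)"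
  proof (rule LIMSEQ_le_const2)
    show "(\<lambda>n. (\<Sum>j<n. c j * T j)\<^sup>2) \<longlonglongrightarrow> s\<^sup>2"
      using s unfolding sums_def by (rule tendsto_power)
    show "\<exists>N. \<forall>n\<ge>N. (\<Sum>j<n. c j * T j)\<^sup>2 \<le> L * (\<Sum>j. \<bar>c j\<bar> * (T j)\<^sup>2)"
    proof (intro exI allI impI)
      fix n
      \<comment> \<open>Each weight is split into two square roots for Cauchy-Schwarz. The sign goes
        into the second factor, where squaring removes it.\<close>
      have "(\<Sum>j<n. c j * T j)\<^sup>2 = (\<Sum>j<n. sqrt \<bar>c j\<bar> * (sgn (c j) * sqrt \<bar>c j\<bar> * T j))\<^sup>2"
        by (intro arg_cong[where f="\<lambda>x. x\<^sup>2"] sum.cong refl) (simp add: sgn_if)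
      also have "\<dots> \<le> (\<Sum>j<n. (sqrt \<bar>c j\<bar>)\<^sup>2) * (\<Sum>j<n. (sgn (c j) * sqrt \<bar>c j\<bar> * T j)\<^sup>2)"
        by (rule Cauchy_Schwarz_ineq_sum)
      also have "\<dots> = (\<Sum>j<n. \<bar>c j\<bar>) * (\<Sum>j<n. \<bar>c j\<bar> * (T j)\<^sup>2)"
        by (auto intro!: sum.cong simp: power_mult_distrib sgn_if)
      also have "\<dots> \<le> L * (\<Sum>j. \<bar>c j\<bar> * (T j)\<^sup>2)"
      proof (rule mult_mono)
        show "(\<Sum>j<n. \<bar>c j\<bar>) \<le> L"
          using sum_le_suminf[OF sums_summable[OF L], of "{..<n}"] sums_unique[OF L] by simp
        show "(\<Sum>j<n. \<bar>c j\<bar> * (T j)\<^sup>2) \<le> (\<Sum>j. \<bar>c j\<bar> * (T j)\<^sup>2)"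
          by (rule sum_le_suminf[OF sm]) auto
      qed (use L0 in \<open>auto intro: sum_nonneg\<close>)
      finally show "(\<Sum>j<n. c j * T j)\<^sup>2 \<le> L * (\<Sum>j. \<bar>c j\<bar> * (T j)\<^sup>2)" .
    qed
  qed
qed

text \<open>A smooth count of the pairs with \<open>e k - e l\<close> or \<open>e k + e l\<close>
  small, diagonal included. Both combinations occur because a product of cosines yields both the
  difference and the sum frequency.\<close>

definition pair_energy :: "('a \<Rightarrow> real) \<Rightarrow> 'a set \<Rightarrow> real" where
  "pair_energy e I = (\<Sum>k\<in>I. \<Sum>l\<in>I. 1 / (1 + (e k - e l)\<^sup>2) + 1 / (1 + (e k + e l)\<^sup>2))"

lemma pair_energy_nonneg: "0 \<le> pair_energy e I"
  unfolding pair_energy_def by (intro sum_nonneg add_nonneg_nonneg) auto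

text \<open>Expand the square, turn products of cosines into sums and integrate each term. The
  factor \<open>2 * real j\<close> only enlarges the frequencies, so one bound serves every mode
  \<open>j\<close>.\<close>

lemma cos_sum_second_moment:
  fixes e :: "'a \<Rightarrow> real" and j :: nat
  assumes "1 \<le> j"
  shows "(\<integral>\<^sup>+t. ennreal ((\<Sum>k\<in>I. cos (2 * real j * (e k * t)))\<^sup>2) \<partial>std_normal_distribution)
    \<le> ennreal (pair_energy e I)"
proof -
  let ?M = std_normal_distribution
  define F where "F k l t = (cos (2 * real j * (e k - e l) * t) + cos (2 * real j * (e k + e l) * t)) / 2"
    for k l t
  have eq: "(\<Sum>k\<in>I. cos (2 * real j * (e k * t)))\<^sup>2 = (\<Sum>k\<in>I. \<Sum>l\<in>I. F k l t)" for t
    unfolding power2_eq_square sum_product F_def cos_times_cos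
    by (intro sum.cong refl) (simp add: algebra_simps)
  have intF: "integrable ?M (F k l)" for k l
    unfolding F_def
    by (intro integrable_divide Bochner_Integration.integrable_add integrable_cos_std_normal)
  have leF: "(LINT t|?M. F k l t) \<le> 1 / (1 + (e k - e l)\<^sup>2) + 1 / (1 + (e k + e l)\<^sup>2)" for k l
  proof -
    have 1: "exp (- ((2 * real j * d)\<^sup>2) / 2) \<le> 1 / (1 + d\<^sup>2)" for d :: real
    proof -
      have "1 \<le> (real j)\<^sup>2" using assms by simp
      then have "1 * d\<^sup>2 \<le> (2 * (real j)\<^sup>2) * d\<^sup>2" by (intro mult_right_mono) auto
      then have "d\<^sup>2 \<le> (2 * real j * d)\<^sup>2 / 2"
        by (simp add: power_mult_distrib mult_ac)
      then have "1 / (1 + (2 * real j * d)\<^sup>2 / 2) \<le> 1 / (1 + d\<^sup>2)"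
        by (intro divide_left_mono) (auto intro!: mult_pos_pos add_pos_nonneg)
      with exp_neg_half_square_le show ?thesis by (rule order_trans)
    qed
    have "(LINT t|?M. F k l t) =
        (exp (- ((2 * real j * (e k - e l))\<^sup>2) / 2) + exp (- ((2 * real j * (e k + e l))\<^sup>2) / 2)) / 2"
      unfolding F_def
      by (simp add: Bochner_Integration.integral_add integrable_cos_std_normal integral_cos_std_normal)
    also have "\<dots> \<le> (1 / (1 + (e k - e l)\<^sup>2) + 1 / (1 + (e k + e l)\<^sup>2)) / 2"
      by (intro divide_right_mono add_mono 1) simp
    also have "\<dots> \<le> 1 / (1 + (e k - e l)\<^sup>2) + 1 / (1 + (e k + e l)\<^sup>2)"
    proof -
      have "y / 2 \<le> y" if "0 \<le> y" for y :: real using that by simp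
      then show ?thesis by (simp only: add_nonneg_nonneg zero_le_divide_1_iff zero_le_power2 zero_le_one)
    qed
    finally show ?thesis .
  qed
  have int: "integrable ?M (\<lambda>t. (\<Sum>k\<in>I. cos (2 * real j * (e k * t)))\<^sup>2)"
    unfolding eq by (intro Bochner_Integration.integrable_sum intF)
  have "(LINT t|?M. (\<Sum>k\<in>I. cos (2 * real j * (e k * t)))\<^sup>2) = (\<Sum>k\<in>I. \<Sum>l\<in>I. LINT t|?M. F k l t)"
    unfolding eq by (simp add: Bochner_Integration.integral_sum Bochner_Integration.integrable_sum intF)
  also have "\<dots> \<le> pair_energy e I"
    unfolding pair_energy_def by (intro sum_mono leF)
  finally show ?thesis
    using nn_integral_eq_integral[OF int] by (simp add: ennreal_leI)
qed

lemma borel_measurable_reg_logcos [measurable]: "reg_logcos r \<in> borel_measurable borel"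
  unfolding reg_logcos_def by measurable

text \<open>Weighted Cauchy-Schwarz over the Fourier modes gives one factor \<open>L\<close>, the
  total coefficient mass. Bounding every mode by the same energy and summing the weights gives the
  other.\<close>

lemma reg_logcos_sum_second_moment:
  fixes e :: "'a \<Rightarrow> real"
  assumes r: "0 \<le> r" "r < 1"
  shows "(\<integral>\<^sup>+t. ennreal ((\<Sum>k\<in>I. reg_logcos r (e k * t))\<^sup>2) \<partial>std_normal_distribution)
    \<le> ennreal ((ln (1 - r))\<^sup>2 * pair_energy e I)"
proof -
  let ?M = std_normal_distribution
  define L where "L = - ln (1 - r)"
  define a where "a j = r ^ j / real j" for j
  define T where "T j t = (\<Sum>k\<in>I. cos (2 * real j * (e k * t)))" for j t
  have a0: "0 \<le> a j" for j using r by (simp add: a_def)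
  have aL: "a sums L" using abs_coeff_sums[OF r] by (simp add: a_def[abs_def] L_def)
  have L0: "0 \<le> L" using r by (simp add: L_def)
  have Tm [measurable]: "T j \<in> borel_measurable borel" for j
    unfolding T_def by measurable
  have pw: "summable (\<lambda>j. a j * (T j t)\<^sup>2) \<and> (\<Sum>k\<in>I. reg_logcos r (e k * t))\<^sup>2 \<le> L * (\<Sum>j. a j * (T j t)\<^sup>2)" for t
  proof -
    let ?c = "\<lambda>j. - ((- r) ^ j) / real j"
    have abs: "\<bar>?c j\<bar> = a j" for j
      using r by (simp add: a_def power_abs)
    have "(\<lambda>j. \<Sum>k\<in>I. ?c j * cos (2 * real j * (e k * t))) sums (\<Sum>k\<in>I. reg_logcos r (e k * t))"
      by (intro sums_sum reg_logcos_sums r)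
    then have 1: "(\<lambda>j. ?c j * T j t) sums (\<Sum>k\<in>I. reg_logcos r (e k * t))"
      by (simp add: T_def sum_distrib_left)
    have 2: "(\<lambda>j. \<bar>?c j\<bar>) sums L" unfolding abs by (rule aL)
    have 3: "\<bar>T j t\<bar> \<le> real (card I)" for j
    proof -
      have "\<bar>T j t\<bar> \<le> (\<Sum>k\<in>I. \<bar>cos (2 * real j * (e k * t))\<bar>)"
        unfolding T_def by (rule sum_abs)
      also have "\<dots> \<le> (\<Sum>k\<in>I. 1)" by (intro sum_mono) simp
      finally show ?thesis by simp
    qed
    from square_suminf_le[of ?c "\<lambda>j. T j t", OF 1 2 3] show ?thesis unfolding abs by blast
  qed
  \<comment> \<open>With nonnegative integrals the series and the integral can be interchanged
    without an integrability condition.\<close>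
  have "(\<integral>\<^sup>+t. ennreal ((\<Sum>k\<in>I. reg_logcos r (e k * t))\<^sup>2) \<partial>?M)
      \<le> (\<integral>\<^sup>+t. (\<Sum>j. ennreal (L * a j) * ennreal ((T j t)\<^sup>2)) \<partial>?M)"
  proof (rule nn_integral_mono)
    fix t
    have "(\<Sum>j. ennreal (L * a j) * ennreal ((T j t)\<^sup>2)) = (\<Sum>j. ennreal (L * (a j * (T j t)\<^sup>2)))"
      using a0 L0 by (simp add: ennreal_mult[symmetric] mult.assoc)
    also have "\<dots> = ennreal (\<Sum>j. L * (a j * (T j t)\<^sup>2))"
      using pw[of t] a0 L0 by (intro suminf_ennreal2) (auto intro: summable_mult)
    also have "(\<Sum>j. L * (a j * (T j t)\<^sup>2)) = L * (\<Sum>j. a j * (T j t)\<^sup>2)"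
      using pw[of t] by (intro suminf_mult) auto
    finally show "ennreal ((\<Sum>k\<in>I. reg_logcos r (e k * t))\<^sup>2) \<le> (\<Sum>j. ennreal (L * a j) * ennreal ((T j t)\<^sup>2))"
      using pw[of t] by (simp add: ennreal_leI)
  qed
  also have "\<dots> = (\<Sum>j. \<integral>\<^sup>+t. ennreal (L * a j) * ennreal ((T j t)\<^sup>2) \<partial>?M)"
    by (intro nn_integral_suminf) measurable
  also have "\<dots> = (\<Sum>j. ennreal (L * a j) * (\<integral>\<^sup>+t. ennreal ((T j t)\<^sup>2) \<partial>?M))"
    by (subst nn_integral_cmult) auto
  also have "\<dots> \<le> (\<Sum>j. ennreal (L * a j) * ennreal (pair_energy e I))"
  proof (intro suminf_le)
    show "ennreal (L * a j) * (\<integral>\<^sup>+t. ennreal ((T j t)\<^sup>2) \<partial>?M) \<le> ennreal (L * a j) * ennreal (pair_energy e I)" for j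
    \<comment> \<open>The constant mode is outside the scope of
      \<open>cos_sum_second_moment\<close>, but its weight \<open>a 0\<close> is
      \<open>1 / 0\<close>, hence 0.\<close>
    proof (cases "j = 0")
      case True
      then show ?thesis by (simp add: a_def)
    next
      case False
      then show ?thesis
        unfolding T_def by (intro mult_left_mono cos_sum_second_moment) auto
    qed
  qed auto
  also have "\<dots> = (\<Sum>j. ennreal (L * a j * pair_energy e I))"
    using a0 L0 by (simp add: ennreal_mult pair_energy_nonneg)
  also have "\<dots> = ennreal (L * L * pair_energy e I)"
  proof -
    have "(\<lambda>j. L * a j * pair_energy e I) sums (L * L * pair_energy e I)"
      by (intro sums_mult sums_mult2 aL)
    then show ?thesis
      using a0 L0 pair_energy_nonneg by (subst suminf_ennreal2) (auto simp: sums_iff intro!: mult_nonneg_nonneg)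
  qed
  finally show ?thesis by (simp add: L_def power2_eq_square)
qed

subsection \<open>The singular remainder\<close>

text \<open>Where \<open>cos x = 0\<close>, the convention for division by zero makes the defect \<open>0\<close> rather than infinite.\<close>

definition reg_defect :: "real \<Rightarrow> real \<Rightarrow> real" where
  "reg_defect r x = ln (1 + (1 - r)\<^sup>2 / (4 * r * (cos x)\<^sup>2)) / 2"

lemma borel_measurable_reg_defect [measurable]: "reg_defect r \<in> borel_measurable borel"
  unfolding reg_defect_def by measurable

lemma reg_defect_nonneg: "0 < r \<Longrightarrow> 0 \<le> reg_defect r x"
  by (simp add: reg_defect_def)

text \<open>Factor \<open>r * (2 * cos x)\<^sup>2\<close> out of the argument of the logarithm in
  \<open>reg_logcos\<close>; the remaining factor is the argument in
  \<open>reg_defect\<close>.\<close>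

lemma ln_cos_decomposition:
  assumes "0 < r" "r < 1" "cos x \<noteq> 0"
  shows "ln \<bar>cos x\<bar> + ln 2 = reg_logcos r x - ln r / 2 - reg_defect r x"
proof -
  have c: "0 < (cos x)\<^sup>2" using assms by simp
  have p: "0 < 1 + (1 - r)\<^sup>2 / (4 * r * (cos x)\<^sup>2)"
    using assms by (intro add_pos_nonneg) auto
  have "(1 - r)\<^sup>2 + 4 * r * (cos x)\<^sup>2 = r * (2 * cos x)\<^sup>2 * (1 + (1 - r)\<^sup>2 / (4 * r * (cos x)\<^sup>2))"
    using assms by (simp add: field_simps)
  then have "ln ((1 - r)\<^sup>2 + 4 * r * (cos x)\<^sup>2) =
      ln r + ln ((2 * cos x)\<^sup>2) + ln (1 + (1 - r)\<^sup>2 / (4 * r * (cos x)\<^sup>2))"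
    using assms c p by (simp add: ln_mult_pos)
  moreover have "ln ((2 * cos x)\<^sup>2) = 2 * (ln \<bar>cos x\<bar> + ln 2)"
  proof -
    have "(2 * cos x)\<^sup>2 = (\<bar>cos x\<bar> * 2)\<^sup>2" by (simp add: power_mult_distrib)
    then show ?thesis using assms(3) by (simp only: ln_realpow ln_mult_pos zero_less_abs_iff) (simp add: ln_realpow ln_mult_pos)
  qed
  ultimately show ?thesis by (simp add: reg_logcos_def reg_defect_def field_simps)
qed

text \<open>Subtracting \<open>ln q / 2\<close> divides the argument by \<open>q\<close>, leaving
  \<open>1 / q + q - 2 + 4 * (cos x)\<^sup>2\<close>, and \<open>1 / q + q\<close> decreases on the
  unit interval. This provides nonnegative approximants of the defect.\<close>

lemma reg_logcos_normalised_antimono: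
  assumes "0 < r" "r \<le> s" "s < 1"
  shows "reg_logcos s x - ln s / 2 \<le> reg_logcos r x - ln r / 2"
proof -
  have eq: "reg_logcos q x - ln q / 2 = ln (1 / q + q - 2 + 4 * (cos x)\<^sup>2) / 2"
    and pos: "0 < 1 / q + q - 2 + 4 * (cos x)\<^sup>2" if "0 < q" "q < 1" for q :: real
  proof -
    have *: "1 / q + q - 2 + 4 * (cos x)\<^sup>2 = ((1 - q)\<^sup>2 + 4 * q * (cos x)\<^sup>2) / q"
      using that by (simp add: field_simps power2_eq_square)
    have p: "0 < (1 - q)\<^sup>2 + 4 * q * (cos x)\<^sup>2"
      using that by (intro reg_logcos_arg_pos) auto
    show "0 < 1 / q + q - 2 + 4 * (cos x)\<^sup>2" unfolding * using p that by simp
    show "reg_logcos q x - ln q / 2 = ln (1 / q + q - 2 + 4 * (cos x)\<^sup>2) / 2"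
      unfolding * using p that by (simp add: reg_logcos_def ln_divide_pos diff_divide_distrib)
  qed
  have "1 / r + r - (1 / s + s) = (s - r) * (1 - r * s) / (r * s)"
    using assms by (simp add: field_simps)
  also have "\<dots> \<ge> 0"
  proof -
    have "r * s \<le> 1" using assms by (intro mult_le_one) auto
    then show ?thesis using assms by (intro divide_nonneg_pos mult_nonneg_nonneg) auto
  qed
  finally have "1 / s + s - 2 + 4 * (cos x)\<^sup>2 \<le> 1 / r + r - 2 + 4 * (cos x)\<^sup>2" by simp
  then have "ln (1 / s + s - 2 + 4 * (cos x)\<^sup>2) \<le> ln (1 / r + r - 2 + 4 * (cos x)\<^sup>2)"
    using assms pos[of s] by (intro ln_mono) auto
  then show ?thesis
    using assms eq[of r] eq[of s] by (simp only: divide_right_mono)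
qed

section \<open>Gaussian mean of the singular remainder\<close>

lemma reg_logcos_mean_sums:
  assumes r: "0 \<le> r" "r < 1"
  shows "integrable std_normal_distribution (\<lambda>t. reg_logcos r (e * t))"
    and "(\<lambda>j. - ((- r) ^ j) / real j * exp (- ((2 * real j * e)\<^sup>2) / 2)) sums
      (LINT t|std_normal_distribution. reg_logcos r (e * t))"
proof -
  let ?M = std_normal_distribution
  let ?f = "\<lambda>j t. - ((- r) ^ j) / real j * cos (2 * real j * (e * t))"
  interpret real_distribution ?M by (rule real_dist_normal_dist)
  have eq: "reg_logcos r (e * t) = (\<Sum>j. ?f j t)" for t
    using reg_logcos_sums[OF r] by (rule sums_unique)
  have 1: "integrable ?M (?f j)" for j
    using integrable_cos_std_normal[of "2 * real j * e"] by (simp add: mult.assoc)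
  have le: "norm (?f j t) \<le> r ^ j / real j" for j t
  proof -
    have "norm (?f j t) = r ^ j / real j * \<bar>cos (2 * real j * (e * t))\<bar>"
      using r by (simp add: abs_mult power_abs)
    also have "\<dots> \<le> r ^ j / real j * 1" using r by (intro mult_left_mono) auto
    finally show ?thesis by simp
  qed
  have sm: "summable (\<lambda>j. r ^ j / real j)" using abs_coeff_sums[OF r] by (rule sums_summable)
  have 2: "AE t in ?M. summable (\<lambda>j. norm (?f j t))"
  proof (rule AE_I2)
    show "summable (\<lambda>j. norm (?f j t))" for t
      using sm by (rule summable_comparison_test'[where N=0]) (use le[of _ t] in simp)
  qed
  have 3: "summable (\<lambda>j. LINT t|?M. norm (?f j t))"
  proof (rule summable_comparison_test'[OF sm, where N=0])
    fix j :: nat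
    have "(LINT t|?M. norm (?f j t)) \<le> (LINT t|?M. r ^ j / real j)"
      by (intro integral_mono integrable_norm 1 le) auto
    then show "norm (LINT t|?M. norm (?f j t)) \<le> r ^ j / real j"
      by (simp add: prob_space[simplified])
  qed
  show "integrable ?M (\<lambda>t. reg_logcos r (e * t))"
    unfolding eq by (rule integrable_suminf[OF 1 2 3])
  have int: "(LINT t|?M. ?f j t) = - ((- r) ^ j) / real j * exp (- ((2 * real j * e)\<^sup>2) / 2)" for j
    using integral_cos_std_normal[of "2 * real j * e"] by (simp add: mult.assoc)
  show "(\<lambda>j. - ((- r) ^ j) / real j * exp (- ((2 * real j * e)\<^sup>2) / 2)) sums
      (LINT t|?M. reg_logcos r (e * t))"
    using sums_integral[OF 1 2 3] unfolding eq int .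
qed

lemma one_minus_power_le:
  fixes r :: real
  assumes "0 \<le> r" "r \<le> 1"
  shows "1 - r ^ j \<le> real j * (1 - r)"
  using Bernoulli_inequality[of "r - 1" j] assms by (simp add: algebra_simps)

text \<open>The coefficients for \<open>r\<close> and \<open>s\<close> differ by at most
  \<open>1 - r\<close> in each mode, and the Gaussian factor supplies the decay in \<open>j\<close>
  that makes the sum converge. The bound is free of \<open>s\<close>, so \<open>s\<close> can be
  sent to 1.\<close>

lemma reg_logcos_mean_diff_le:
  assumes "0 \<le> r" "r \<le> s" "s < 1" "e \<noteq> 0"
  shows "(LINT t|std_normal_distribution. reg_logcos r (e * t)) - (LINT t|std_normal_distribution. reg_logcos s (e * t))
     \<le> (1 - r) * ((\<Sum>j. 1 / (real j)\<^sup>2) / (2 * e\<^sup>2))"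
proof (rule sums_le)
  let ?E = "\<lambda>j. exp (- ((2 * real j * e)\<^sup>2) / 2)"
  show "(\<lambda>j. - ((- r) ^ j) / real j * ?E j - - ((- s) ^ j) / real j * ?E j) sums
     ((LINT t|std_normal_distribution. reg_logcos r (e * t)) - (LINT t|std_normal_distribution. reg_logcos s (e * t)))"
    using assms by (intro sums_diff reg_logcos_mean_sums) auto
  have "summable (\<lambda>j. 1 / (real j)\<^sup>2)"
    using inverse_power_summable[of 2, where 'a=real] by (simp add: inverse_eq_divide)
  then have "(\<lambda>j. 1 / (real j)\<^sup>2) sums (\<Sum>j. 1 / (real j)\<^sup>2)" by (rule summable_sums)
  then show "(\<lambda>j. (1 - r) * (1 / (real j)\<^sup>2 / (2 * e\<^sup>2))) sums ((1 - r) * ((\<Sum>j. 1 / (real j)\<^sup>2) / (2 * e\<^sup>2)))"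
    by (intro sums_mult sums_divide)
  show "- ((- r) ^ j) / real j * ?E j - - ((- s) ^ j) / real j * ?E j \<le> (1 - r) * (1 / (real j)\<^sup>2 / (2 * e\<^sup>2))" for j
  proof (cases "j = 0")
    case False
    then have j: "0 < real j" by simp
    have rs: "r ^ j \<le> s ^ j" using assms by (intro power_mono) auto
    \<comment> \<open>The alternating sign is discarded by passing to the absolute value, and
      \<open>s ^ j \<le> 1\<close> removes \<open>s\<close>.\<close>
    have "- ((- r) ^ j) - - ((- s) ^ j) = (- 1) ^ j * (s ^ j - r ^ j)"
      using power_minus[of r j] power_minus[of s j] by (simp add: algebra_simps)
    also have "\<dots> \<le> \<bar>(- 1) ^ j * (s ^ j - r ^ j)\<bar>" by (rule abs_ge_self)
    also have "\<dots> = s ^ j - r ^ j" using rs by (simp add: abs_mult)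
    also have "\<dots> \<le> 1 - r ^ j" using assms by (simp add: power_le_one)
    also have "\<dots> \<le> real j * (1 - r)" using assms by (intro one_minus_power_le) auto
    finally have 1: "(- ((- r) ^ j) - - ((- s) ^ j)) / real j \<le> 1 - r"
      using j by (simp add: field_simps)
    have "?E j \<le> 1 / (1 + (2 * real j * e)\<^sup>2 / 2)" by (rule exp_neg_half_square_le)
    also have "\<dots> \<le> 1 / ((2 * real j * e)\<^sup>2 / 2)"
      using j assms by (intro divide_left_mono) (auto intro!: mult_pos_pos add_pos_nonneg)
    also have "\<dots> = 1 / (real j)\<^sup>2 / (2 * e\<^sup>2)" by (simp add: power_mult_distrib)
    finally have 2: "?E j \<le> 1 / (real j)\<^sup>2 / (2 * e\<^sup>2)" .
    have "- ((- r) ^ j) / real j * ?E j - - ((- s) ^ j) / real j * ?E j =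
        (- ((- r) ^ j) - - ((- s) ^ j)) / real j * ?E j"
      by (simp only: diff_divide_distrib left_diff_distrib)
    also have "\<dots> \<le> (1 - r) * ?E j" using 1 by (rule mult_right_mono) simp
    also have "\<dots> \<le> (1 - r) * (1 / (real j)\<^sup>2 / (2 * e\<^sup>2))"
      using 2 assms by (intro mult_left_mono) auto
    finally show ?thesis .
  qed simp
qed

lemma neg_half_ln_le:
  fixes r :: real
  assumes "1 / 2 \<le> r" "r < 1"
  shows "- ln r / 2 \<le> 1 - r"
proof -
  have "- ln r = ln (1 / r)" using assms by (simp add: ln_div)
  also have "\<dots> \<le> 1 / r - 1" using assms by (intro ln_le_minus_one) auto
  also have "\<dots> = (1 - r) * (1 / r)" using assms by (simp add: field_simps)
  also have "\<dots> \<le> (1 - r) * 2" using assms by (intro mult_left_mono) (auto simp: field_simps)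
  finally show ?thesis by simp
qed

lemma AE_cos_nonzero: "AE t in std_normal_distribution. e \<noteq> 0 \<longrightarrow> cos (e * t) \<noteq> 0"
proof (cases "e = 0")
  case False
  have "countable {t. cos (e * t) = 0}"
  proof (rule countable_subset)
    show "{t. cos (e * t) = 0} \<subseteq> (\<lambda>n. of_int n * (pi / 2) / e) ` (UNIV :: int set)"
      using False by (auto simp: cos_zero_iff_int image_iff field_simps)
  qed simp
  then have "AE t in lborel. t \<notin> {t. cos (e * t) = 0}"
    using countable_imp_null_set_lborel AE_not_in by blast
  then show ?thesis by (auto simp: AE_density)
qed simp

text \<open>At \<open>e = 0\<close> the quotient below is \<open>0\<close>, and the bound still holds.\<close>

lemma reg_defect_mean_le:
  assumes r: "1 / 2 \<le> r" "r < 1"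
  shows "(\<integral>\<^sup>+t. ennreal (reg_defect r (e * t)) \<partial>std_normal_distribution)
    \<le> ennreal ((1 - r) * (1 + (\<Sum>j. 1 / (real j)\<^sup>2) / (2 * e\<^sup>2)))"
proof (cases "e = 0")
  case True
  interpret real_distribution std_normal_distribution by (rule real_dist_normal_dist)
  have "ln (1 + (1 - r)\<^sup>2 / (4 * r)) \<le> (1 - r)\<^sup>2 / (4 * r)"
    using r by (intro ln_add_one_self_le_self) auto
  also have "\<dots> \<le> (1 - r)\<^sup>2 / 1"
    using r by (intro divide_left_mono) auto
  also have "\<dots> \<le> (1 - r) * 1"
    unfolding power2_eq_square using r by simp
  finally have "reg_defect r 0 \<le> 1 - r" using r by (simp add: reg_defect_def)
  then show ?thesis using True emeasure_space_1 by (simp add: ennreal_leI)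
next
  case False
  let ?M = std_normal_distribution
  let ?B = "(1 - r) * (1 + (\<Sum>j. 1 / (real j)\<^sup>2) / (2 * e\<^sup>2))"
  \<comment> \<open>A sequence in the interval from \<open>r\<close> to 1, starting at
    \<open>r\<close> and tending to 1.\<close>
  define s where "s n = 1 - (1 - r) / real (Suc n)" for n
  have s: "r \<le> s n" "s n < 1" for n
  proof -
    have "(1 - r) / real (Suc n) \<le> (1 - r) / 1" using r by (intro divide_left_mono) auto
    then show "r \<le> s n" by (simp add: s_def)
    show "s n < 1" using r by (simp add: s_def)
  qed
  \<comment> \<open>Where the cosine is nonzero, this equals the defect at \<open>r\<close> minus
    the defect at \<open>s n\<close>. It is nonnegative, tends to the defect at \<open>r\<close>,
    and has a mean computable from Fourier series; Fatou's lemma then bounds the mean of the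
    defect.\<close>
  define D where "D n t = (reg_logcos r (e * t) - ln r / 2) - (reg_logcos (s n) (e * t) - ln (s n) / 2)" for n t
  have Dm [measurable]: "D n \<in> borel_measurable borel" for n unfolding D_def by measurable
  have D0: "0 \<le> D n t" for n t
    unfolding D_def using reg_logcos_normalised_antimono[of r "s n" "e * t"] r s[of n] by simp
  have lim: "(\<lambda>n. D n t) \<longlonglongrightarrow> reg_defect r (e * t)" if c: "cos (e * t) \<noteq> 0" for t
  proof -
    have "D n t = reg_defect r (e * t) - reg_defect (s n) (e * t)" for n
      using ln_cos_decomposition[OF _ _ c, of r] ln_cos_decomposition[OF _ _ c, of "s n"] r s[of n]
      by (simp add: D_def)
    moreover have "(\<lambda>n. reg_defect (s n) (e * t)) \<longlonglongrightarrow> 0"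
    proof -
      have "s \<longlonglongrightarrow> 1 - 0"
        unfolding s_def by (intro tendsto_diff tendsto_const) real_asymp
      then have "(\<lambda>n. ln (1 + (1 - s n)\<^sup>2 / (4 * s n * (cos (e * t))\<^sup>2)) / 2) \<longlonglongrightarrow>
          ln (1 + (1 - (1 - 0))\<^sup>2 / (4 * (1 - 0) * (cos (e * t))\<^sup>2)) / 2"
        using c by (intro tendsto_intros) auto
      then show ?thesis by (simp add: reg_defect_def)
    qed
    ultimately show ?thesis using tendsto_diff[OF tendsto_const, of _ 0] by fastforce
  qed
  have "(\<integral>\<^sup>+t. ennreal (reg_defect r (e * t)) \<partial>?M) = (\<integral>\<^sup>+t. liminf (\<lambda>n. ennreal (D n t)) \<partial>?M)"
  proof (rule nn_integral_cong_AE)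
    show "AE t in ?M. ennreal (reg_defect r (e * t)) = liminf (\<lambda>n. ennreal (D n t))"
      using AE_cos_nonzero[of e]
    proof eventually_elim
      case (elim t)
      then have "(\<lambda>n. ennreal (D n t)) \<longlonglongrightarrow> ennreal (reg_defect r (e * t))"
        using False by (intro tendsto_ennrealI lim) auto
      then show ?case by (intro lim_imp_Liminf[symmetric]) auto
    qed
  qed
  also have "\<dots> \<le> liminf (\<lambda>n. \<integral>\<^sup>+t. ennreal (D n t) \<partial>?M)"
    by (rule nn_integral_liminf) measurable
  also have "\<dots> \<le> liminf (\<lambda>n. ennreal ?B)"
  proof (intro Liminf_mono always_eventually allI)
    fix n
    interpret real_distribution ?M by (rule real_dist_normal_dist)
    have int: "integrable ?M (\<lambda>t. reg_logcos r (e * t))" "integrable ?M (\<lambda>t. reg_logcos (s n) (e * t))"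
      using r s[of n] by (auto intro!: reg_logcos_mean_sums(1))
    then have intD: "integrable ?M (D n)"
      unfolding D_def by (intro Bochner_Integration.integrable_diff) auto
    have "(LINT t|?M. D n t) = ((LINT t|?M. reg_logcos r (e * t)) - (LINT t|?M. reg_logcos (s n) (e * t)))
        - ln r / 2 + ln (s n) / 2"
      unfolding D_def using int by (simp add: prob_space[simplified])
    also have "\<dots> \<le> (1 - r) * ((\<Sum>j. 1 / (real j)\<^sup>2) / (2 * e\<^sup>2)) + (1 - r)"
    proof -
      have "ln (s n) \<le> 0" using r s[of n] by (subst ln_le_zero_iff) auto
      moreover have "(LINT t|?M. reg_logcos r (e * t)) - (LINT t|?M. reg_logcos (s n) (e * t))
          \<le> (1 - r) * ((\<Sum>j. 1 / (real j)\<^sup>2) / (2 * e\<^sup>2))"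
        using r s[of n] False by (intro reg_logcos_mean_diff_le) auto
      ultimately show ?thesis
        using neg_half_ln_le[OF r] by linarith
    qed
    also have "\<dots> = ?B" by (simp add: algebra_simps)
    finally show "(\<integral>\<^sup>+t. ennreal (D n t) \<partial>?M) \<le> ennreal ?B"
      using nn_integral_eq_integral[OF intD] D0 by (simp add: ennreal_leI)
  qed
  also have "\<dots> = ennreal ?B" by (simp add: Liminf_const)
  finally show ?thesis .
qed

subsection \<open>The Weyl growth condition\<close>

text \<open>The exponent \<open>p\<close> stands for \<open>1 + \<epsilon>\<close>. The range of
  \<open>n\<close> starts at 2 because \<open>ln 1 = 0\<close>: at \<open>n = 1\<close> division by
  zero would turn the threshold into 0 and demand separation from every other index.\<close>

definition weyl_growth :: "(nat \<Rightarrow> real) \<Rightarrow> real \<Rightarrow> real \<Rightarrow> bool" where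
  "weyl_growth e p \<delta> \<longleftrightarrow> (\<forall>n\<ge>2. \<forall>m\<ge>1.
     real n / ln (real n) powr p < \<bar>real n - real m\<bar> \<longrightarrow> \<delta> < \<bar>e n - e m\<bar>)"

text \<open>Apply the growth condition at the largest index \<open>k\<close> in the window: all
  other indices in the window lie within \<open>k / ln k powr p\<close> below
  \<open>k\<close>.\<close>

lemma weyl_growth_window_card_le:
  assumes w: "weyl_growth e p \<delta>" and p: "0 \<le> p" and N: "2 \<le> N"
  shows "real (card {l \<in> {1..N}. a \<le> e l \<and> e l \<le> a + \<delta>})
    \<le> sqrt (real N) + 1 + 2 powr p * real N / ln (real N) powr p"
proof -
  let ?A = "{l \<in> {1..N}. a \<le> e l \<and> e l \<le> a + \<delta>}"
  have t0: "0 \<le> 2 powr p * real N / ln (real N) powr p" by simp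
  show ?thesis
  proof (cases "?A = {}")
    case True
    then show ?thesis using t0 by (simp only: True) simp
  next
    case False
    define k where "k = Max ?A"
    have kA: "k \<in> ?A" unfolding k_def using False by (intro Max_in) auto
    have kmax: "m \<le> k" if "m \<in> ?A" for m unfolding k_def using that by (intro Max_ge) auto
    show ?thesis
    \<comment> \<open>If \<open>k\<close> is at most the root of \<open>N\<close>, counting all
      indices up to \<open>k\<close> suffices. Otherwise \<open>ln k\<close> is at least half of
      \<open>ln N\<close>, which costs the factor \<open>2 powr p\<close>.\<close>
    proof (cases "real k \<le> sqrt (real N)")
      case True
      have "?A \<subseteq> {1..k}" using kmax by auto
      then have "card ?A \<le> card {1..k}" by (intro card_mono) auto
      then have "real (card ?A) \<le> real k" by simp
      then show ?thesis using t0 True by linarith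
    next
      case False
      have "1 \<le> sqrt (real N)" using N by simp
      with False have k2: "2 \<le> k" by linarith
      define v where "v = real k / ln (real k) powr p"
      have v0: "0 \<le> v" by (simp add: v_def)
      have "?A \<subseteq> {k - nat \<lfloor>v\<rfloor>..k}"
      proof
        fix m assume m: "m \<in> ?A"
        have "\<not> \<delta> < \<bar>e k - e m\<bar>" using m kA by auto
        then have "\<bar>real k - real m\<bar> \<le> v"
          using w k2 m unfolding weyl_growth_def v_def by force
        then have "int k - int m \<le> \<lfloor>v\<rfloor>" by (simp add: le_floor_iff)
        then show "m \<in> {k - nat \<lfloor>v\<rfloor>..k}" using kmax[OF m] by auto
      qed
      then have "card ?A \<le> card {k - nat \<lfloor>v\<rfloor>..k}" by (intro card_mono) auto
      also have "\<dots> \<le> nat \<lfloor>v\<rfloor> + 1" by simp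
      finally have "real (card ?A) \<le> v + 1" using v0 by linarith
      also have "v \<le> real N / (ln (real N) / 2) powr p"
      proof -
        have "ln (real N) / 2 = ln (sqrt (real N))" by (simp add: ln_sqrt)
        also have "\<dots> \<le> ln (real k)" using False N by (intro ln_mono) auto
        finally have "(ln (real N) / 2) powr p \<le> ln (real k) powr p"
          using N p by (intro powr_mono2) auto
        then show ?thesis
          unfolding v_def using kA N k2 by (intro frac_le) auto
      qed
      also have "real N / (ln (real N) / 2) powr p = 2 powr p * real N / ln (real N) powr p"
        using N by (simp add: powr_divide)
      finally have "real (card ?A) \<le> 2 powr p * real N / ln (real N) powr p + 1" by simp
      then show ?thesis using \<open>1 \<le> sqrt (real N)\<close> by linarith
    qed
  qed
qed

text \<open>Sort the points by their distance from \<open>x\<close> in steps of \<delta>. Each bin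
  is covered by one window on either side of \<open>x\<close>, hence the factor 2, and on bin
  \<open>m\<close> the kernel is at most its value at distance \<open>\<delta> * m\<close>.\<close>

lemma sum_kernel_le:
  fixes e :: "'a \<Rightarrow> real"
  assumes I: "finite I" and \<delta>: "0 < \<delta>"
    and W: "\<And>a. real (card {l \<in> I. a \<le> e l \<and> e l \<le> a + \<delta>}) \<le> W"
  shows "(\<Sum>l\<in>I. 1 / (1 + (x - e l)\<^sup>2)) \<le> 2 * W * (\<Sum>m. 1 / (1 + (\<delta> * real m)\<^sup>2))"
proof -
  define bin where "bin l = nat \<lfloor>\<bar>x - e l\<bar> / \<delta>\<rfloor>" for l
  define c where "c m = 1 / (1 + (\<delta> * real m)\<^sup>2)" for m :: nat
  have c0: "0 \<le> c m" for m by (simp add: c_def)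
  have W0: "0 \<le> W" using W[of 0] by (rule order_trans[rotated]) simp
  have csum: "summable c"
  proof (rule summable_comparison_test_bigo)
    show "summable (\<lambda>m. norm (1 / (real m)\<^sup>2))"
      using inverse_power_summable[of 2, where 'a=real] by (simp add: inverse_eq_divide)
    show "c \<in> O(\<lambda>m. 1 / (real m)\<^sup>2)" unfolding c_def using \<delta> by real_asymp
  qed
  have bin: "\<delta> * real (bin l) \<le> \<bar>x - e l\<bar>" "\<bar>x - e l\<bar> \<le> \<delta> * real (bin l) + \<delta>" for l
  proof -
    have "0 \<le> \<bar>x - e l\<bar> / \<delta>" using \<delta> by simp
    then have "real (bin l) \<le> \<bar>x - e l\<bar> / \<delta>" "\<bar>x - e l\<bar> / \<delta> \<le> real (bin l) + 1"
      unfolding bin_def by linarith+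
    then show "\<delta> * real (bin l) \<le> \<bar>x - e l\<bar>" "\<bar>x - e l\<bar> \<le> \<delta> * real (bin l) + \<delta>"
      using \<delta> by (simp_all add: field_simps)
  qed
  have cnt: "real (card {l \<in> I. bin l = m}) \<le> 2 * W" for m
  proof -
    let ?U = "{l \<in> I. x + \<delta> * real m \<le> e l \<and> e l \<le> x + \<delta> * real m + \<delta>}"
    \<comment> \<open>The upper end is left unsimplified so that the set matches the window in the
      hypothesis \<open>W\<close>.\<close>
    let ?V = "{l \<in> I. x - \<delta> * real m - \<delta> \<le> e l \<and> e l \<le> x - \<delta> * real m - \<delta> + \<delta>}"
    have "{l \<in> I. bin l = m} \<subseteq> ?U \<union> ?V"
    proof
      fix l assume "l \<in> {l \<in> I. bin l = m}"
      then show "l \<in> ?U \<union> ?V" using bin[of l] by (auto simp: abs_if split: if_splits)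
    qed
    then have "card {l \<in> I. bin l = m} \<le> card (?U \<union> ?V)" using I by (intro card_mono) auto
    also have "\<dots> \<le> card ?U + card ?V" by (rule card_Un_le)
    finally have "real (card {l \<in> I. bin l = m}) \<le> real (card ?U) + real (card ?V)" by simp
    also have "\<dots> \<le> W + W" by (intro add_mono W)
    finally show ?thesis by simp
  qed
  have "(\<Sum>l\<in>I. 1 / (1 + (x - e l)\<^sup>2)) \<le> (\<Sum>l\<in>I. c (bin l))"
  proof (rule sum_mono)
    fix l
    have "(\<delta> * real (bin l))\<^sup>2 \<le> \<bar>x - e l\<bar>\<^sup>2"
      using bin(1)[of l] \<delta> by (intro power_mono) auto
    then show "1 / (1 + (x - e l)\<^sup>2) \<le> c (bin l)"
      unfolding c_def by (intro divide_left_mono) (auto intro!: mult_pos_pos add_pos_nonneg)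
  qed
  also have "\<dots> = (\<Sum>m\<in>bin ` I. \<Sum>l\<in>{l \<in> I. bin l = m}. c (bin l))"
    using I by (rule sum.image_gen)
  also have "\<dots> = (\<Sum>m\<in>bin ` I. real (card {l \<in> I. bin l = m}) * c m)"
    by (intro sum.cong refl) simp
  also have "\<dots> \<le> (\<Sum>m\<in>bin ` I. 2 * W * c m)"
    by (intro sum_mono mult_right_mono cnt c0)
  also have "\<dots> = 2 * W * (\<Sum>m\<in>bin ` I. c m)" by (simp add: sum_distrib_left)
  also have "\<dots> \<le> 2 * W * (\<Sum>m. c m)"
    using W0 I c0 csum by (intro mult_left_mono sum_le_suminf) auto
  finally show ?thesis by (simp add: c_def)
qed

text \<open>For fixed \<open>k\<close> the energy is two kernel sums, centred at \<open>e k\<close>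
  and at \<open>- e k\<close>, and the window count controls both.\<close>

lemma weyl_growth_pair_energy_le:
  assumes w: "weyl_growth e p \<delta>" and p: "0 < p" and \<delta>: "0 < \<delta>"
  obtains C where "\<forall>\<^sub>F N in sequentially. pair_energy e {1..N} \<le> C * (real N)\<^sup>2 / ln (real N) powr p"
proof
  define Q where "Q = (\<Sum>m. 1 / (1 + (\<delta> * real m)\<^sup>2))"
  have ev: "\<forall>\<^sub>F N in sequentially. sqrt (real N) + 1 \<le> real N / ln (real N) powr p"
    using p by real_asymp
  \<comment> \<open>The constant collects \<open>2 * W * Q\<close> from each of the two kernel sums.
    In \<open>W\<close>, the summand 1 beside \<open>2 powr p\<close> absorbs
    \<open>sqrt N + 1\<close>.\<close>
  show "\<forall>\<^sub>F N in sequentially. pair_energy e {1..N} \<le> (4 * Q * (1 + 2 powr p)) * (real N)\<^sup>2 / ln (real N) powr p"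
    using ev eventually_ge_at_top[of 2]
  proof eventually_elim
    case (elim N)
    define W where "W = (1 + 2 powr p) * real N / ln (real N) powr p"
    have W: "real (card {l \<in> {1..N}. a \<le> e l \<and> e l \<le> a + \<delta>}) \<le> W" for a
    proof -
      have "real (card {l \<in> {1..N}. a \<le> e l \<and> e l \<le> a + \<delta>})
          \<le> sqrt (real N) + 1 + 2 powr p * real N / ln (real N) powr p"
        using weyl_growth_window_card_le[OF w _ elim(2)] p by simp
      also have "\<dots> \<le> real N / ln (real N) powr p + 2 powr p * real N / ln (real N) powr p"
        using elim(1) by simp
      also have "\<dots> = W" by (simp add: W_def add_divide_distrib algebra_simps)
      finally show ?thesis .
    qed
    have K: "(\<Sum>l\<in>{1..N}. 1 / (1 + (x - e l)\<^sup>2)) \<le> 2 * W * Q" for x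
      unfolding Q_def by (rule sum_kernel_le[OF _ \<delta> W]) simp
    have "pair_energy e {1..N} = (\<Sum>k\<in>{1..N}. (\<Sum>l\<in>{1..N}. 1 / (1 + (e k - e l)\<^sup>2)) + (\<Sum>l\<in>{1..N}. 1 / (1 + (- e k - e l)\<^sup>2)))"
      unfolding pair_energy_def sum.distrib by (simp add: power2_eq_square algebra_simps)
    also have "\<dots> \<le> (\<Sum>k\<in>{1..N}. 2 * W * Q + 2 * W * Q)"
      by (intro sum_mono add_mono K)
    also have "\<dots> = (4 * Q * (1 + 2 powr p)) * (real N)\<^sup>2 / ln (real N) powr p"
      by (simp add: W_def power2_eq_square)
    finally show ?case .
  qed
qed

text \<open>If some \<open>e m\<close> is within \<open>\<delta> / 2\<close> of 0, every
  sufficiently late \<open>e k\<close> is more than \<delta> away from it, because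
  \<open>k / ln k powr p\<close> is of smaller order than \<open>k\<close>.\<close>

lemma weyl_growth_eventually_away_from_zero:
  assumes w: "weyl_growth e p \<delta>" and p: "0 < p"
  shows "\<forall>\<^sub>F k in sequentially. \<delta> / 2 \<le> \<bar>e k\<bar>"
proof (cases "\<exists>m\<ge>1. \<bar>e m\<bar> < \<delta> / 2")
  case True
  then obtain m where m: "1 \<le> m" "\<bar>e m\<bar> < \<delta> / 2" by blast
  have "\<forall>\<^sub>F k in sequentially. real k / ln (real k) powr p < \<bar>real k - real m\<bar>"
    using p by real_asymp
  then show ?thesis
    using eventually_ge_at_top[of 2]
  proof eventually_elim
    case (elim k)
    then have "\<delta> < \<bar>e k - e m\<bar>" using w m by (auto simp: weyl_growth_def)
    with m show ?case by linarith
  qed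
next
  case False
  then show ?thesis
    by (intro eventually_mono[OF eventually_ge_at_top[of 1]]) (auto simp: not_less)
qed

text \<open>The finitely many early indices only enlarge the bound, and a vanishing
  \<open>e k\<close> contributes 0 by the convention for division.\<close>

lemma weyl_growth_inverse_square_bounded:
  assumes w: "weyl_growth e p \<delta>" and p: "0 < p" and \<delta>: "0 < \<delta>"
  obtains B where "\<And>k. 1 / (e k)\<^sup>2 \<le> B"
proof -
  have "Bseq (\<lambda>k. 1 / (e k)\<^sup>2)"
  proof (rule BfunI)
    show "\<forall>\<^sub>F k in sequentially. norm (1 / (e k)\<^sup>2) \<le> 1 / (\<delta> / 2)\<^sup>2"
      using weyl_growth_eventually_away_from_zero[OF w p]
    proof eventually_elim
      case (elim k)
      then have "(\<delta> / 2)\<^sup>2 \<le> \<bar>e k\<bar>\<^sup>2" using \<delta> by (intro power_mono) auto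
      moreover have "0 < (\<delta> / 2)\<^sup>2" using \<delta> by (intro zero_less_power) auto
      ultimately have "1 / (e k)\<^sup>2 \<le> 1 / (\<delta> / 2)\<^sup>2" by (intro frac_le) auto
      then show ?case by simp
    qed
  qed
  then obtain B where "\<forall>k. norm (1 / (e k)\<^sup>2) \<le> B" by (rule BseqE)
  then show ?thesis using that[of B] by simp
qed

subsection \<open>Convergence of the averages\<close>

text \<open>For \<open>n\<close> between consecutive terms of \<nu>, monotonicity traps the average
  between two subsequence averages, up to the ratio of those terms. The ratio tends to 1 because
  increments of \<open>i powr \<alpha>\<close> vanish when \<alpha> is below 1.\<close>

lemma average_tendsto_of_sparse_subsequence:
  fixes S :: "nat \<Rightarrow> real"
  assumes \<alpha>: "0 < \<alpha>" "\<alpha> < 1" and mono: "mono S" and nonneg: "\<And>n. 0 \<le> S n"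
  defines "\<nu> \<equiv> \<lambda>i::nat. nat \<lfloor>exp (real i powr \<alpha>)\<rfloor>"
  assumes lim: "(\<lambda>i. S (\<nu> i) / real (\<nu> i)) \<longlonglongrightarrow> L"
  shows "(\<lambda>n. S n / real n) \<longlonglongrightarrow> L"
proof -
  \<comment> \<open>The inverse function of \<open>exp (i powr \<alpha>)\<close>, rounded down: it
    locates \<open>n\<close> between two consecutive values of \<nu>.\<close>
  define ix where "ix n = nat \<lfloor>ln (real n) powr (1 / \<alpha>)\<rfloor>" for n :: nat
  have \<nu>_pos: "1 \<le> \<nu> i" for i
  proof -
    have "1 \<le> exp (real i powr \<alpha>)" by simp
    then show ?thesis unfolding \<nu>_def by (simp add: le_nat_iff le_floor_iff)
  qed
  have \<nu>_bounds: "exp (real i powr \<alpha>) - 1 \<le> real (\<nu> i)" "real (\<nu> i) \<le> exp (real i powr \<alpha>)" for i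
  proof -
    have "0 \<le> exp (real i powr \<alpha>)" by simp
    then show "exp (real i powr \<alpha>) - 1 \<le> real (\<nu> i)" "real (\<nu> i) \<le> exp (real i powr \<alpha>)"
      unfolding \<nu>_def by linarith+
  qed
  have ratio: "(\<lambda>i. real (\<nu> (Suc i)) / real (\<nu> i)) \<longlonglongrightarrow> 1"
  proof (rule tendsto_sandwich)
    show "(\<lambda>i. (exp (real (Suc i) powr \<alpha>) - 1) / exp (real i powr \<alpha>)) \<longlonglongrightarrow> 1"
      using \<alpha> by real_asymp
    show "(\<lambda>i. exp (real (Suc i) powr \<alpha>) / (exp (real i powr \<alpha>) - 1)) \<longlonglongrightarrow> 1"
      using \<alpha> by real_asymp
    show "\<forall>\<^sub>F i in sequentially. (exp (real (Suc i) powr \<alpha>) - 1) / exp (real i powr \<alpha>) \<le> real (\<nu> (Suc i)) / real (\<nu> i)"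
      using \<nu>_pos
      by (intro always_eventually allI frac_le \<nu>_bounds) (auto simp: Suc_le_eq simp del: of_nat_Suc)
    show "\<forall>\<^sub>F i in sequentially. real (\<nu> (Suc i)) / real (\<nu> i) \<le> exp (real (Suc i) powr \<alpha>) / (exp (real i powr \<alpha>) - 1)"
      \<comment> \<open>The index 0 is excluded because the denominator
        \<open>exp (i powr \<alpha>) - 1\<close> vanishes there.\<close>
      by (intro eventually_mono[OF eventually_gt_at_top[of 0]] frac_le \<nu>_bounds) auto
  qed
  have ix_lim: "filterlim ix at_top sequentially"
    unfolding ix_def using \<alpha> by real_asymp
  have between: "\<nu> (ix n) \<le> n \<and> n \<le> \<nu> (Suc (ix n))" if n: "1 \<le> n" for n
  proof -
    define y where "y = ln (real n) powr (1 / \<alpha>)"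
    have y0: "0 \<le> y" by (simp add: y_def)
    have ya: "y powr \<alpha> = ln (real n)" using n \<alpha> by (simp add: y_def powr_powr)
    have iy: "real (ix n) \<le> y" "y \<le> real (Suc (ix n))"
      unfolding ix_def y_def[symmetric] using y0 by linarith+
    have "exp (real (ix n) powr \<alpha>) \<le> exp (y powr \<alpha>)" using iy \<alpha> by (simp add: powr_mono2)
    also have "\<dots> = real n" using n ya by simp
    finally have 1: "real (\<nu> (ix n)) \<le> real n" using \<nu>_bounds(2)[of "ix n"] by linarith
    have "real n = exp (y powr \<alpha>)" using n ya by simp
    also have "\<dots> \<le> exp (real (Suc (ix n)) powr \<alpha>)" using iy y0 \<alpha> by (simp add: powr_mono2 del: of_nat_Suc)
    finally have "int n \<le> \<lfloor>exp (real (Suc (ix n)) powr \<alpha>)\<rfloor>" by (simp add: le_floor_iff)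
    then have "n \<le> \<nu> (Suc (ix n))" unfolding \<nu>_def by linarith
    with 1 show ?thesis by simp
  qed
  show ?thesis
  proof (rule tendsto_sandwich)
    have "(\<lambda>i. S (\<nu> i) / real (\<nu> i) / (real (\<nu> (Suc i)) / real (\<nu> i))) \<longlonglongrightarrow> L / 1"
      by (intro tendsto_divide lim ratio) auto
    then show "(\<lambda>n. S (\<nu> (ix n)) / real (\<nu> (ix n)) / (real (\<nu> (Suc (ix n))) / real (\<nu> (ix n)))) \<longlonglongrightarrow> L"
      using filterlim_compose[OF _ ix_lim] by fastforce
    have "(\<lambda>i. S (\<nu> (Suc i)) / real (\<nu> (Suc i)) * (real (\<nu> (Suc i)) / real (\<nu> i))) \<longlonglongrightarrow> L * 1"
      by (intro tendsto_mult ratio LIMSEQ_Suc[OF lim])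
    then show "(\<lambda>n. S (\<nu> (Suc (ix n))) / real (\<nu> (Suc (ix n))) * (real (\<nu> (Suc (ix n))) / real (\<nu> (ix n)))) \<longlonglongrightarrow> L"
      using filterlim_compose[OF _ ix_lim] by fastforce
    show "\<forall>\<^sub>F n in sequentially. S (\<nu> (ix n)) / real (\<nu> (ix n)) / (real (\<nu> (Suc (ix n))) / real (\<nu> (ix n))) \<le> S n / real n"
      using eventually_ge_at_top[of 1]
    proof eventually_elim
      case (elim n)
      have "S (\<nu> (ix n)) / real (\<nu> (ix n)) / (real (\<nu> (Suc (ix n))) / real (\<nu> (ix n))) = S (\<nu> (ix n)) / real (\<nu> (Suc (ix n)))"
        using \<nu>_pos[of "ix n"] by simp
      also have "\<dots> \<le> S n / real n"
        using between[OF elim] elim nonneg monoD[OF mono] by (intro frac_le) auto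
      finally show ?case .
    qed
    show "\<forall>\<^sub>F n in sequentially. S n / real n \<le> S (\<nu> (Suc (ix n))) / real (\<nu> (Suc (ix n))) * (real (\<nu> (Suc (ix n))) / real (\<nu> (ix n)))"
      using eventually_ge_at_top[of 1]
    proof eventually_elim
      case (elim n)
      have "S n / real n \<le> S (\<nu> (Suc (ix n))) / real (\<nu> (ix n))"
        using between[OF elim] elim nonneg monoD[OF mono] \<nu>_pos[of "ix n"] by (intro frac_le) auto
      also have "\<dots> = S (\<nu> (Suc (ix n))) / real (\<nu> (Suc (ix n))) * (real (\<nu> (Suc (ix n))) / real (\<nu> (ix n)))"
        using \<nu>_pos[of "Suc (ix n)"] by simp
      finally show ?case .
    qed
  qed
qed

theorem theorem5:
  fixes e :: "nat \<Rightarrow> real"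
  assumes weyl: "\<exists>\<epsilon>>0. \<exists>\<delta>>0. \<forall>n\<ge>2. \<forall>m\<ge>1.
      real n / (ln (real n)) powr (1 + \<epsilon>) < \<bar>real n - real m\<bar> \<longrightarrow> \<delta> < \<bar>e n - e m\<bar>"
  shows "AE t in lborel. (\<lambda>n. ln \<bar>decoh e n t\<bar> / real n) \<longlonglongrightarrow> - ln 2"
proof (rule AE_std_normal_imp_lborel)
  let ?M = std_normal_distribution
  obtain \<epsilon> \<delta> where \<epsilon>: "0 < \<epsilon>" and \<delta>: "0 < \<delta>" and w: "weyl_growth e (1 + \<epsilon>) \<delta>"
    using weyl unfolding weyl_growth_def by blast
  define p where "p = 1 + \<epsilon>"
  have p: "0 < p" and w: "weyl_growth e p \<delta>" using \<epsilon> w by (simp_all add: p_def)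
  \<comment> \<open>Chosen so that \<open>\<alpha> * p\<close> exceeds 1, for summability, while
    \<alpha> itself stays below 1, for the interpolation between subsequence terms.\<close>
  define \<alpha> where "\<alpha> = (1 + \<epsilon> / 2) / p"
  have \<alpha>: "0 < \<alpha>" "\<alpha> < 1" and \<alpha>p: "\<alpha> * p = 1 + \<epsilon> / 2"
    using \<epsilon> by (simp_all add: \<alpha>_def p_def field_simps)
  define \<nu> where "\<nu> i = nat \<lfloor>exp (real i powr \<alpha>)\<rfloor>" for i :: nat
  \<comment> \<open>The gap \<open>1 - r i\<close> is summable, yet the square of its logarithm
    grows slower than any power of \<open>i\<close>. The shift by 2 keeps \<open>r i\<close> above
    one half from the start.\<close>
  define r where "r i = 1 - 1 / (real i + 2)\<^sup>2" for i :: nat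
  have r: "1 / 2 \<le> r i" "r i < 1" for i
  proof -
    have "2\<^sup>2 \<le> (real i + 2)\<^sup>2" by (intro power_mono) auto
    then have "1 / (real i + 2)\<^sup>2 \<le> 1 / 2\<^sup>2" by (intro divide_left_mono) (auto intro!: mult_pos_pos zero_less_power add_nonneg_pos)
    then show "1 / 2 \<le> r i" by (simp add: r_def)
    have "0 < (real i + 2)\<^sup>2" by (intro zero_less_power) simp
    then show "r i < 1" by (simp add: r_def)
  qed
  have \<nu>_pos: "1 \<le> \<nu> i" for i
    unfolding \<nu>_def by (simp add: le_nat_iff le_floor_iff)
  have \<nu>_lim: "filterlim \<nu> at_top sequentially"
    unfolding \<nu>_def using \<alpha> by real_asymp

  have AE_X: "AE t in ?M. (\<lambda>i. ((\<Sum>k\<in>{1..\<nu> i}. reg_logcos (r i) (e k * t)) / real (\<nu> i))\<^sup>2) \<longlonglongrightarrow> 0"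
  proof -
    obtain C where C: "\<forall>\<^sub>F N in sequentially. pair_energy e {1..N} \<le> C * (real N)\<^sup>2 / ln (real N) powr p"
      using weyl_growth_pair_energy_le[OF w p \<delta>] .
    \<comment> \<open>The factor \<open>2 powr p\<close> pays for the estimate
      \<open>ln (\<nu> i) \<ge> i powr \<alpha> / 2\<close>, which absorbs the rounding in \<nu>.
      The absolute value is taken because the sign of \<open>C\<close> is unknown.\<close>
    define b where "b i = (\<bar>C\<bar> * 2 powr p) * ((ln (1 - r i))\<^sup>2 * real i powr - (1 + \<epsilon> / 2))" for i
    show ?thesis
    proof (rule AE_tendsto_0_of_summable_nn_integral)
      show "0 \<le> b i" for i by (simp add: b_def)
      show "summable b"
        unfolding b_def
      proof (rule summable_mult, rule summable_comparison_test_bigo)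
        show "summable (\<lambda>i. norm (real i powr - (1 + \<epsilon> / 4)))"
          using \<epsilon> by (simp add: summable_real_powr_iff)
        \<comment> \<open>Lowering the exponent from \<open>1 + \<epsilon> / 2\<close> to
          \<open>1 + \<epsilon> / 4\<close> absorbs the squared logarithm.\<close>
        show "(\<lambda>i. (ln (1 - r i))\<^sup>2 * real i powr - (1 + \<epsilon> / 2)) \<in> O(\<lambda>i. real i powr - (1 + \<epsilon> / 4))"
          unfolding r_def using \<epsilon> by real_asymp
      qed
      have "\<forall>\<^sub>F i in sequentially. real i powr \<alpha> / 2 \<le> ln (exp (real i powr \<alpha>) - 1)"
        using \<alpha> by real_asymp
      then show "\<forall>\<^sub>F i in sequentially.
          (\<integral>\<^sup>+t. ennreal (((\<Sum>k\<in>{1..\<nu> i}. reg_logcos (r i) (e k * t)) / real (\<nu> i))\<^sup>2) \<partial>?M) \<le> ennreal (b i)"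
        using eventually_compose_filterlim[OF C \<nu>_lim] eventually_gt_at_top[of 0]
      proof eventually_elim
        case (elim i)
        let ?E = "pair_energy e {1..\<nu> i}"
        have "exp (real i powr \<alpha>) - 1 \<le> real (\<nu> i)" unfolding \<nu>_def by linarith
        moreover have "0 < exp (real i powr \<alpha>) - 1" using elim(3) by simp
        ultimately have "real i powr \<alpha> / 2 \<le> ln (real (\<nu> i))"
          using elim(1) ln_mono[of "exp (real i powr \<alpha>) - 1" "real (\<nu> i)"] by linarith
        then have "(real i powr \<alpha> / 2) powr p \<le> ln (real (\<nu> i)) powr p"
          using p by (intro powr_mono2) auto
        moreover have "(real i powr \<alpha> / 2) powr p = real i powr (1 + \<epsilon> / 2) / 2 powr p"
          by (simp add: powr_divide powr_powr \<alpha>p)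
        ultimately have lnb: "real i powr (1 + \<epsilon> / 2) / 2 powr p \<le> ln (real (\<nu> i)) powr p" by simp
        have "?E / (real (\<nu> i))\<^sup>2 \<le> C / ln (real (\<nu> i)) powr p"
          using elim(2) \<nu>_pos[of i] by (simp add: divide_le_eq)
        also have "\<dots> \<le> \<bar>C\<bar> / (real i powr (1 + \<epsilon> / 2) / 2 powr p)"
          using lnb elim(3) by (intro frac_le) auto
        also have "\<dots> = (\<bar>C\<bar> * 2 powr p) * real i powr - (1 + \<epsilon> / 2)"
          unfolding powr_minus_divide by simp
        finally have Eb: "(ln (1 - r i))\<^sup>2 * (?E / (real (\<nu> i))\<^sup>2)
            \<le> (ln (1 - r i))\<^sup>2 * ((\<bar>C\<bar> * 2 powr p) * real i powr - (1 + \<epsilon> / 2))"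
          by (rule mult_left_mono) simp
        have "(\<integral>\<^sup>+t. ennreal (((\<Sum>k\<in>{1..\<nu> i}. reg_logcos (r i) (e k * t)) / real (\<nu> i))\<^sup>2) \<partial>?M)
            = (\<integral>\<^sup>+t. ennreal (1 / (real (\<nu> i))\<^sup>2) * ennreal ((\<Sum>k\<in>{1..\<nu> i}. reg_logcos (r i) (e k * t))\<^sup>2) \<partial>?M)"
          by (simp add: ennreal_mult[symmetric] power_divide)
        also have "\<dots> = ennreal (1 / (real (\<nu> i))\<^sup>2) *
            (\<integral>\<^sup>+t. ennreal ((\<Sum>k\<in>{1..\<nu> i}. reg_logcos (r i) (e k * t))\<^sup>2) \<partial>?M)"
          by (rule nn_integral_cmult) measurable
        also have "\<dots> \<le> ennreal (1 / (real (\<nu> i))\<^sup>2) * ennreal ((ln (1 - r i))\<^sup>2 * ?E)"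
          using r[of i] by (intro mult_left_mono reg_logcos_sum_second_moment) auto
        also have "\<dots> = ennreal ((ln (1 - r i))\<^sup>2 * (?E / (real (\<nu> i))\<^sup>2))"
          by (simp add: ennreal_mult[symmetric] pair_energy_nonneg)
        also have "\<dots> \<le> ennreal (b i)"
          using Eb by (intro ennreal_leI) (simp only: b_def mult_ac)
        finally show ?case .
      qed
    qed auto
  qed

  have AE_Y: "AE t in ?M. (\<lambda>i. (\<Sum>k\<in>{1..\<nu> i}. reg_defect (r i) (e k * t)) / real (\<nu> i)) \<longlonglongrightarrow> 0"
  proof -
    obtain B where B: "\<And>k. 1 / (e k)\<^sup>2 \<le> B"
      using weyl_growth_inverse_square_bounded[OF w p \<delta>] by blast
    define Q :: real where "Q = (\<Sum>j. 1 / (real j)\<^sup>2)"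
    have Q0: "0 \<le> Q"
      unfolding Q_def using inverse_power_summable[of 2, where 'a=real]
      by (intro suminf_nonneg) (auto simp: inverse_eq_divide)
    have B0: "0 \<le> B" using B[of 0] by (rule order_trans[rotated]) simp
    \<comment> \<open>Bounds the bracket in \<open>reg_defect_mean_le\<close> uniformly in
      \<open>k\<close>, so averaging over \<open>k\<close> loses nothing.\<close>
    define D where "D = 1 + Q / 2 * B"
    have D0: "0 \<le> D" using Q0 B0 by (simp add: D_def)
    show ?thesis
    proof (rule AE_tendsto_0_of_summable_nn_integral)
      show "0 \<le> (\<Sum>k\<in>{1..\<nu> i}. reg_defect (r i) (e k * t)) / real (\<nu> i)" for i t
        using r(1)[of i] by (intro divide_nonneg_nonneg sum_nonneg reg_defect_nonneg) auto
      show "0 \<le> (1 - r i) * D" for i using r(2)[of i] D0 by simp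
      show "summable (\<lambda>i. (1 - r i) * D)"
      proof (rule summable_mult2, rule summable_comparison_test_bigo)
        show "summable (\<lambda>i. norm (1 / (real i)\<^sup>2))"
          using inverse_power_summable[of 2, where 'a=real] by (simp add: inverse_eq_divide)
        show "(\<lambda>i. 1 - r i) \<in> O(\<lambda>i. 1 / (real i)\<^sup>2)"
          unfolding r_def by real_asymp
      qed
      show "\<forall>\<^sub>F i in sequentially.
          (\<integral>\<^sup>+t. ennreal ((\<Sum>k\<in>{1..\<nu> i}. reg_defect (r i) (e k * t)) / real (\<nu> i)) \<partial>?M) \<le> ennreal ((1 - r i) * D)"
      proof (intro always_eventually allI)
        fix i
        have nn: "0 \<le> reg_defect (r i) x" for x using r(1)[of i] by (intro reg_defect_nonneg) auto
        have "(\<integral>\<^sup>+t. ennreal ((\<Sum>k\<in>{1..\<nu> i}. reg_defect (r i) (e k * t)) / real (\<nu> i)) \<partial>?M)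
            = (\<integral>\<^sup>+t. ennreal (1 / real (\<nu> i)) * (\<Sum>k\<in>{1..\<nu> i}. ennreal (reg_defect (r i) (e k * t))) \<partial>?M)"
          using nn by (simp add: sum_ennreal ennreal_mult[symmetric] sum_nonneg)
        also have "\<dots> = ennreal (1 / real (\<nu> i)) * (\<integral>\<^sup>+t. (\<Sum>k\<in>{1..\<nu> i}. ennreal (reg_defect (r i) (e k * t))) \<partial>?M)"
          by (rule nn_integral_cmult) measurable
        also have "\<dots> = ennreal (1 / real (\<nu> i)) * (\<Sum>k\<in>{1..\<nu> i}. \<integral>\<^sup>+t. ennreal (reg_defect (r i) (e k * t)) \<partial>?M)"
          by (subst nn_integral_sum) auto
        also have "\<dots> \<le> ennreal (1 / real (\<nu> i)) * (\<Sum>k\<in>{1..\<nu> i}. ennreal ((1 - r i) * D))"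
        proof (intro mult_left_mono sum_mono)
          fix k
          have "Q / (2 * (e k)\<^sup>2) = Q / 2 * (1 / (e k)\<^sup>2)" by simp
          also have "\<dots> \<le> Q / 2 * B" using Q0 B by (intro mult_left_mono) auto
          finally have "(1 - r i) * (1 + Q / (2 * (e k)\<^sup>2)) \<le> (1 - r i) * D"
            unfolding D_def using r(2)[of i] by (intro mult_left_mono) auto
          then show "(\<integral>\<^sup>+t. ennreal (reg_defect (r i) (e k * t)) \<partial>?M) \<le> ennreal ((1 - r i) * D)"
            using reg_defect_mean_le[OF r[of i], of "e k"] unfolding Q_def
            by (meson ennreal_leI order_trans)
        qed auto
        also have "\<dots> = ennreal ((1 - r i) * D)"
        proof -
          have "0 \<le> (1 - r i) * D" using r(2)[of i] D0 by simp
          then have "ennreal (1 / real (\<nu> i)) * (\<Sum>k\<in>{1..\<nu> i}. ennreal ((1 - r i) * D))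
              = ennreal (1 / real (\<nu> i) * (\<Sum>k\<in>{1..\<nu> i}. (1 - r i) * D))"
            by (subst sum_ennreal, simp, subst ennreal_mult[symmetric]) (auto simp: sum_nonneg)
          also have "1 / real (\<nu> i) * (\<Sum>k\<in>{1..\<nu> i}. (1 - r i) * D) = (1 - r i) * D"
            using \<nu>_pos[of i] by simp
          finally show ?thesis .
        qed
        finally show "(\<integral>\<^sup>+t. ennreal ((\<Sum>k\<in>{1..\<nu> i}. reg_defect (r i) (e k * t)) / real (\<nu> i)) \<partial>?M)
            \<le> ennreal ((1 - r i) * D)" .
      qed
    qed auto
  qed

  have AE_cos: "AE t in ?M. \<forall>k. e k \<noteq> 0 \<longrightarrow> cos (e k * t) \<noteq> 0"
    unfolding AE_all_countable using AE_cos_nonzero by blast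

  from AE_X AE_Y AE_cos show "AE t in ?M. (\<lambda>n. ln \<bar>decoh e n t\<bar> / real n) \<longlonglongrightarrow> - ln 2"
  proof eventually_elim
    case (elim t)
    \<comment> \<open>When \<open>e k = 0\<close> the cosine is 1.\<close>
    have c: "cos (e k * t) \<noteq> 0" for k using elim(3) by (cases "e k = 0") auto
    define S where "S n = (\<Sum>k=1..n. - ln \<bar>cos (e k * t)\<bar>)" for n
    have summand_nonneg: "0 \<le> - ln \<bar>cos (e k * t)\<bar>" for k using c[of k] by simp
    have "mono S"
      unfolding S_def by (intro monoI sum_mono2) (use summand_nonneg in auto)
    moreover have "0 \<le> S n" for n unfolding S_def by (intro sum_nonneg summand_nonneg)
    moreover have "(\<lambda>i. S (\<nu> i) / real (\<nu> i)) \<longlonglongrightarrow> ln 2"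
    proof -
      let ?X = "\<lambda>i. (\<Sum>k\<in>{1..\<nu> i}. reg_logcos (r i) (e k * t)) / real (\<nu> i)"
      let ?Y = "\<lambda>i. (\<Sum>k\<in>{1..\<nu> i}. reg_defect (r i) (e k * t)) / real (\<nu> i)"
      have eq: "S (\<nu> i) / real (\<nu> i) = ln 2 - ?X i + ln (r i) / 2 + ?Y i" for i
      proof -
        have "- ln \<bar>cos (e k * t)\<bar> = (ln 2 + ln (r i) / 2) - reg_logcos (r i) (e k * t) + reg_defect (r i) (e k * t)" for k
          using ln_cos_decomposition[of "r i" "e k * t"] r[of i] c[of k] by auto
        then have "S (\<nu> i) = real (\<nu> i) * (ln 2 + ln (r i) / 2)
            - (\<Sum>k\<in>{1..\<nu> i}. reg_logcos (r i) (e k * t)) + (\<Sum>k\<in>{1..\<nu> i}. reg_defect (r i) (e k * t))"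
          unfolding S_def by (simp add: sum.distrib sum_subtractf)
        then show ?thesis using \<nu>_pos[of i] by (simp add: add_divide_distrib diff_divide_distrib)
      qed
      \<comment> \<open>The second moment bound gave convergence of the squares; taking roots
        recovers \<open>?X\<close> itself.\<close>
      have X: "?X \<longlonglongrightarrow> 0"
        using tendsto_real_sqrt[OF elim(1)] unfolding real_sqrt_abs real_sqrt_zero
        by (rule tendsto_rabs_zero_cancel)
      have "(\<lambda>i. ln (r i)) \<longlonglongrightarrow> 0" unfolding r_def by real_asymp
      from tendsto_add[OF tendsto_add[OF tendsto_diff[OF tendsto_const X] tendsto_divide[OF this tendsto_const, of 2]] elim(2), of "ln 2"]
      show ?thesis unfolding eq by simp
    qed
    ultimately have "(\<lambda>n. S n / real n) \<longlonglongrightarrow> ln 2"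
      using average_tendsto_of_sparse_subsequence[OF \<alpha>, of S "ln 2"] unfolding \<nu>_def by blast
    moreover have "ln \<bar>decoh e n t\<bar> = - S n" for n
      unfolding decoh_def S_def abs_prod using c by (subst ln_prod) (auto simp: sum_negf)
    ultimately show ?case using tendsto_minus by fastforce
  qed
qed

end
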